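(* Let $\mathcal A=\{a_1,\dots,a_m\}\subset\mathbb R^n$ be a finite nonempty set, let $\mathcal M=\mathrm{conv}(\mathcal A)$, and let $f:\mathbb R^n\to\mathbb R$ be continuously differentiable. Let $\{x^k\}_{k\ge0}$ be a sequence of points produced by the Optimize, Refine & Drop (ORD) algorithm (defined in the context) applied to $\min_{x\in\mathcal M}f(x)$, where at every iteration $$\mathcal D^k=\{a\in\mathcal A^k:\ a=A^ke_h\ \text{and}\ \bar y^k_h=0\}.$$ Assume that $\lim_{k\to\infty}x^k=x^*$. Then there exists an iteration $\bar k$ such that, for all $k\ge\bar k$ and all $a\in\mathcal A$, $$\nabla f(x^* )^T(a-x^* )>0\ \Rightarrow\ a\notin\mathcal A^k.$$
   Context: Notation. $\Delta_{p-1}=\{w\in\mathbb R^p: e^Tw=1,\ w\ge 0\}$, where $e$ is the all-ones vector; $e_i$ is the $i$-th canonical basis vector. Line Search Procedure$(z,d,\hat\alpha,\gamma,\delta)$ for $\varphi$ on $\Delta_{p-1}$: (1) Compute the largest $\bar\alpha$ with $z+\bar\alpha d\in\Delta_{p-1}$ and set $\alpha=\min\{\bar\alpha,\hat\alpha\}$. (2) If $\alpha>0$ and $\varphi(z+\alpha d)\le\varphi(z)-\gamma\alpha^2$, go to (6). (3) Compute the largest $\bar\alpha$ with $z-\bar\alpha d\in\Delta_{p-1}$ and set $\alpha=\min\{\bar\alpha,\hat\alpha\}$. (4) If $\alpha>0$ and $\varphi(z-\alpha d)\le\varphi(z)-\gamma\alpha^2$, set $d=-d$ and go to (6). (5) Set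 $\alpha=0$ and go to (8). (6) Let $\beta=\min\{\bar\alpha,\alpha/\delta\}$. (7) While $\alpha<\bar\alpha$ and $\varphi(z+\beta d)\le\varphi(z)-\gamma\beta^2$: set $\alpha=\beta$ and then $\beta=\min\{\bar\alpha,\alpha/\delta\}$. (8) Return $\alpha,d$. Algorithm DF-SIMPLEX with tolerance $\epsilon>0$, for $\min_{y\in\Delta_{p-1}}\varphi(y)$ with $\varphi:\mathbb R^p\to\mathbb R$ continuously differentiable. Input: $y^0\in\Delta_{p-1}$, $\tau\in(0,1]$, $\theta\in(0,1)$, $\gamma>0$, $\delta\in(0,1)$, $\hat\alpha^0_1,\dots,\hat\alpha^0_p>0$. At each iteration $l=0,1,\dots$: choose $j_l$ with $y^l_{j_l}\ge\tau\max_i y^l_i$; set $z^l_1=y^l$. For $i=1,\dots,p$: if $i\ne j_l$, compute $\alpha,d$ by Line Search Procedure$(z^l_i,e_i-e_{j_l},\hat\alpha^l_i,\gamma,\delta)$, and set $\hat\alpha^{l+1}_i=\max\{\theta\hat\alpha^l_i,\epsilon\}$ if $\alpha=0$, $\hat\alpha^{l+1}_i=\alpha$ otherwise; if $i=j_l$, set $\alpha=0$, $d=0$. Set $\alpha^l_i=\alpha$, $d^l_i=d$, $z^l_{i+1}=z^l_i+\alpha^l_id^l_i$. After the loop on $i$, set $\hat\alpha^{l+1}_{j_l}=\min\bigl(\{\hat\alpha^{l+1}_i: i\ne j_l\}\cup\{\hat\alpha^l_{j_l}\}\bigr)$ and $y^{l+1}=z^l_{p+1}$. The algorithm stops and returns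 $y^l$ at the first iteration $l$ such that $\hat\alpha^l_i=\epsilon$ for all $i\in\{1,\dots,p\}$ and $\alpha^l_i=0$ for all $i\ne j_l$. ORD algorithm. Choose positive scalars $\epsilon^k$ decreasing to $0$, $\mathcal A^0\subseteq\mathcal A$, $a_{i_0}\in\mathcal A^0$; set $x^0=a_{i_0}$, $y^0=e_{i_0}\in\mathbb R^{|\mathcal A^0|}$ (the basis vector corresponding to the atom $a_{i_0}$); choose $\hat\mu^0\in(0,1)$, $\gamma>0$, $\theta\in(0,1)$ ($\gamma,\theta$ may differ from the ones used inside DF-SIMPLEX). For $k=0,1,\dots$: Optimize phase: let $A^k$ be the matrix whose columns are the atoms in $\mathcal A^k$ (so $x^k=A^ky^k$); run DF-SIMPLEX from $y^k$ with tolerance $\epsilon^k$ on $\min_{y\in\Delta_{|\mathcal A^k|-1}}\varphi^k(y)$, $\varphi^k(y)=f(A^ky)$, let $\bar y^k$ be the returned point and set $\bar x^k=A^k\bar y^k$. Refine phase: if there exist $a_{i_k}\in\mathcal A\setminus\mathcal A^k$ and $\mu^k\in[\hat\mu^k,1]$ with $f(\bar x^k+\mu^k(a_{i_k}-\bar x^k))\le f(\bar x^k)-\gamma(\mu^k)^2$, then set $x^{k+1}=\bar x^k+\mu^k(a_{i_k}-\bar x^k)$, $\mathcal R^k=\{a_{i_k}\}$, $\hat\mu^{k+1}=\hat\mu^k$ for one such choice; otherwise set $x^{k+1}=\bar x^k$, $\mathcal R^k=\emptyset$, $\hat\mu^{k+1}=\theta\hat\mu^k$. Drop phase: choose a subset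 $\mathcal D^k\subseteq\{a\in\mathcal A^k: a=A^ke_h \text{ and } \bar y^k_h=0\}$ (the specific choice is prescribed in the claim); let $\mathcal A^{k+1}=(\mathcal A^k\cup\mathcal R^k)\setminus\mathcal D^k$ and choose $y^{k+1}\in\Delta_{|\mathcal A^{k+1}|-1}$ such that $x^{k+1}=A^{k+1}y^{k+1}$. Conventions: the DF-SIMPLEX parameters $\tau,\theta,\gamma,\delta$ are the same for all $k$; each inner run of DF-SIMPLEX is finite and returns $\bar y^k$ (if $|\mathcal A^k|=1$ the feasible set is a single point and $\bar y^k=y^k$). *)

theory Defs
  imports "HOL-Analysis.Analysis"
begin

text \<open>
  Since the dimension \<open>p\<close> of the simplex changes along a run, a vector of \<open>\<real>\<^sup>p\<close> is a function
  \<open>nat \<Rightarrow> real\<close> vanishing outside \<open>{..<p}\<close>. All indices are 0-based.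
\<close>

type_synonym rvec = "nat \<Rightarrow> real"

definition unit_simplex :: "nat \<Rightarrow> rvec set" where
  "unit_simplex p = {w. (\<Sum>i<p. w i) = 1 \<and> (\<forall>i<p. 0 \<le> w i) \<and> (\<forall>i\<ge>p. w i = 0)}"

definition basis_vec :: "nat \<Rightarrow> rvec" where
  "basis_vec h = (\<lambda>i. if i = h then 1 else 0)"

definition step_along :: "rvec \<Rightarrow> real \<Rightarrow> rvec \<Rightarrow> rvec" where
  "step_along z \<alpha> d = (\<lambda>i. z i + \<alpha> * d i)"

text \<open>
  The greatest element exists whenever \<open>z\<close> lies in the simplex and \<open>d\<close> is a nonzero vector of
  \<open>\<real>\<^sup>p\<close>, which is the only case in which it is used.
\<close>

definition max_step :: "nat \<Rightarrow> rvec \<Rightarrow> rvec \<Rightarrow> real" where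
  "max_step p z d = (GREATEST \<alpha>. step_along z \<alpha> d \<in> unit_simplex p)"

definition suff_decrease :: "(rvec \<Rightarrow> real) \<Rightarrow> real \<Rightarrow> rvec \<Rightarrow> real \<Rightarrow> rvec \<Rightarrow> bool" where
  "suff_decrease \<phi> \<gamma> z \<alpha> d \<longleftrightarrow> \<phi> (step_along z \<alpha> d) \<le> \<phi> z - \<gamma> * \<alpha>\<^sup>2"

text \<open>
  Big-step semantics of the expansion loop of the line search: \<open>expand \<phi> \<gamma> \<delta> z d \<alpha>bar \<alpha> \<alpha>'\<close> means
  that the loop entered with step \<open>\<alpha>\<close> exits with step \<open>\<alpha>'\<close>. The trial step \<open>\<beta>\<close> of the loop is
  always \<open>min \<alpha>bar (\<alpha> / \<delta>)\<close> when the guard is tested.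
\<close>

inductive expand ::
  "(rvec \<Rightarrow> real) \<Rightarrow> real \<Rightarrow> real \<Rightarrow> rvec \<Rightarrow> rvec \<Rightarrow> real \<Rightarrow> real \<Rightarrow> real \<Rightarrow> bool"
  for \<phi> \<gamma> \<delta> z d \<alpha>bar
where
  exit: "\<not> (\<alpha> < \<alpha>bar \<and> suff_decrease \<phi> \<gamma> z (min \<alpha>bar (\<alpha> / \<delta>)) d)
    \<Longrightarrow> expand \<phi> \<gamma> \<delta> z d \<alpha>bar \<alpha> \<alpha>"
| loop: "\<alpha> < \<alpha>bar \<Longrightarrow> suff_decrease \<phi> \<gamma> z (min \<alpha>bar (\<alpha> / \<delta>)) d
    \<Longrightarrow> expand \<phi> \<gamma> \<delta> z d \<alpha>bar (min \<alpha>bar (\<alpha> / \<delta>)) \<alpha>' \<Longrightarrow> expand \<phi> \<gamma> \<delta> z d \<alpha>bar \<alpha> \<alpha>'"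

text \<open>
  \<open>line_search \<phi> p z d \<alpha>hat \<gamma> \<delta> \<alpha> d'\<close>: the procedure returns step \<open>\<alpha>\<close> and direction \<open>d'\<close>.
\<close>

definition line_search ::
  "(rvec \<Rightarrow> real) \<Rightarrow> nat \<Rightarrow> rvec \<Rightarrow> rvec \<Rightarrow> real \<Rightarrow> real \<Rightarrow> real \<Rightarrow> real \<Rightarrow> rvec \<Rightarrow> bool"
where
  "line_search \<phi> p z d \<alpha>hat \<gamma> \<delta> \<alpha> d' \<longleftrightarrow>
    (let nd = (\<lambda>i. - d i);
         bar1 = max_step p z d; \<alpha>1 = min bar1 \<alpha>hat;
         bar2 = max_step p z nd; \<alpha>2 = min bar2 \<alpha>hat
     in if \<alpha>1 > 0 \<and> suff_decrease \<phi> \<gamma> z \<alpha>1 d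
          then d' = d \<and> expand \<phi> \<gamma> \<delta> z d bar1 \<alpha>1 \<alpha>
        else if \<alpha>2 > 0 \<and> suff_decrease \<phi> \<gamma> z \<alpha>2 nd
          then d' = nd \<and> expand \<phi> \<gamma> \<delta> z nd bar2 \<alpha>2 \<alpha>
        else d' = d \<and> \<alpha> = 0)"

text \<open>
  One iteration of DF-SIMPLEX from the point \<open>y\<close> with tentative steps \<open>\<alpha>hat\<close> and chosen index \<open>j\<close>.
  It records the steps \<open>\<alpha> i\<close>, directions \<open>d i\<close> and intermediate points \<open>z 0 = y, \<dots>, z p\<close>, and
  produces the next tentative steps \<open>\<alpha>hat'\<close>; the next point is \<open>z p\<close>.
\<close>

definition df_simplex_iteration ::
  "(rvec \<Rightarrow> real) \<Rightarrow> nat \<Rightarrow> real \<Rightarrow> real \<Rightarrow> real \<Rightarrow> real \<Rightarrow> real \<Rightarrow> rvec \<Rightarrow> rvec \<Rightarrow> nat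
    \<Rightarrow> (nat \<Rightarrow> real) \<Rightarrow> (nat \<Rightarrow> rvec) \<Rightarrow> (nat \<Rightarrow> rvec) \<Rightarrow> rvec \<Rightarrow> bool"
where
  "df_simplex_iteration \<phi> p \<epsilon> \<tau> \<theta> \<gamma> \<delta> y \<alpha>hat j \<alpha> d z \<alpha>hat' \<longleftrightarrow>
    j < p \<and> y j \<ge> \<tau> * Max (y ` {..<p}) \<and>
    z 0 = y \<and>
    (\<forall>i<p.
      (if i = j then \<alpha> i = 0 \<and> d i = (\<lambda>_. 0)
       else line_search \<phi> p (z i) (\<lambda>h. basis_vec i h - basis_vec j h) (\<alpha>hat i) \<gamma> \<delta> (\<alpha> i) (d i) \<and>
            \<alpha>hat' i = (if \<alpha> i = 0 then max (\<theta> * \<alpha>hat i) \<epsilon> else \<alpha> i)) \<and>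
      z (Suc i) = step_along (z i) (\<alpha> i) (d i)) \<and>
    \<alpha>hat' j = Min (\<alpha>hat' ` ({..<p} - {j}) \<union> {\<alpha>hat j})"

text \<open>
  \<open>df_simplex_returns \<phi> p \<epsilon> \<tau> \<theta> \<gamma> \<delta> \<alpha>hat0 y0 ybar\<close>: some (finite) run of DF-SIMPLEX started at
  \<open>y0\<close> with initial steps \<open>\<alpha>hat0\<close> stops, and it returns \<open>ybar\<close>.
\<close>

definition df_simplex_returns ::
  "(rvec \<Rightarrow> real) \<Rightarrow> nat \<Rightarrow> real \<Rightarrow> real \<Rightarrow> real \<Rightarrow> real \<Rightarrow> real \<Rightarrow> rvec \<Rightarrow> rvec \<Rightarrow> rvec \<Rightarrow> bool"
where
  "df_simplex_returns \<phi> p \<epsilon> \<tau> \<theta> \<gamma> \<delta> \<alpha>hat0 y0 ybar \<longleftrightarrow>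
    (\<exists>(L::nat) (y :: nat \<Rightarrow> rvec) (\<alpha>hat :: nat \<Rightarrow> rvec) (j :: nat \<Rightarrow> nat)
        (\<alpha> :: nat \<Rightarrow> nat \<Rightarrow> real) (d :: nat \<Rightarrow> nat \<Rightarrow> rvec) (z :: nat \<Rightarrow> nat \<Rightarrow> rvec).
      let stops = (\<lambda>l. (\<forall>i<p. \<alpha>hat l i = \<epsilon>) \<and> (\<forall>i<p. i \<noteq> j l \<longrightarrow> \<alpha> l i = 0))
      in y 0 = y0 \<and> \<alpha>hat 0 = \<alpha>hat0 \<and>
         (\<forall>l\<le>L. df_simplex_iteration \<phi> p \<epsilon> \<tau> \<theta> \<gamma> \<delta> (y l) (\<alpha>hat l) (j l) (\<alpha> l) (d l) (z l)
                   (\<alpha>hat (Suc l)) \<and>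
                 y (Suc l) = z l p) \<and>
         stops L \<and> (\<forall>l<L. \<not> stops l) \<and>
         ybar = y L)"

text \<open>The product of the matrix with the given list of columns and a vector.\<close>

definition cols_mult :: "'a::real_vector list \<Rightarrow> rvec \<Rightarrow> 'a" where
  "cols_mult cols y = (\<Sum>i<length cols. y i *\<^sub>R cols ! i)"

text \<open>
  A run of the ORD algorithm. The parameters \<open>\<tau> \<theta> \<gamma> \<delta>\<close> belong to DF-SIMPLEX, while \<open>\<theta>r \<gamma>r\<close> are those
  of the refine phase. \<open>Ak k\<close> is the current set of atoms, \<open>cols k\<close> an enumeration of it (the
  columns of the matrix), and \<open>\<mu>hat k\<close>, \<open>R k\<close>, \<open>D k\<close> are the smallest allowed step, the added atoms and
  the dropped atoms. The initial steps of the inner runs may depend on \<open>k\<close>.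
\<close>

locale ORD_run =
  fixes f :: "'a::euclidean_space \<Rightarrow> real"
    and A :: "'a set"
    and \<tau> \<theta> \<gamma> \<delta> \<theta>r \<gamma>r :: real
    and \<epsilon> \<mu>hat :: "nat \<Rightarrow> real"
    and Ak :: "nat \<Rightarrow> 'a set"
    and cols :: "nat \<Rightarrow> 'a list"
    and x xbar :: "nat \<Rightarrow> 'a"
    and y ybar :: "nat \<Rightarrow> rvec"
    and R D :: "nat \<Rightarrow> 'a set"
  assumes df_params: "0 < \<tau>" "\<tau> \<le> 1" "0 < \<theta>" "\<theta> < 1" "0 < \<gamma>" "0 < \<delta>" "\<delta> < 1"
    and ord_params: "0 < \<theta>r" "\<theta>r < 1" "0 < \<gamma>r" "0 < \<mu>hat 0" "\<mu>hat 0 < 1"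
    and eps: "\<And>k. 0 < \<epsilon> k" "decseq \<epsilon>" "\<epsilon> \<longlonglongrightarrow> 0"
    and columns: "\<And>k. distinct (cols k)" "\<And>k. set (cols k) = Ak k"
    and init: "Ak 0 \<subseteq> A"
      "\<exists>h<length (cols 0). x 0 = cols 0 ! h \<and> y 0 = basis_vec h"
    and optimize: "\<And>k.
      if card (Ak k) = 1 then ybar k = y k
      else \<exists>\<alpha>hat0. (\<forall>i<card (Ak k). 0 < \<alpha>hat0 i) \<and>
        df_simplex_returns (\<lambda>v. f (cols_mult (cols k) v)) (card (Ak k)) (\<epsilon> k) \<tau> \<theta> \<gamma> \<delta>
          \<alpha>hat0 (y k) (ybar k)"
      "\<And>k. xbar k = cols_mult (cols k) (ybar k)"
    and refine: "\<And>k.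
      let ok = (\<lambda>a \<mu>. a \<in> A - Ak k \<and> \<mu> \<in> {\<mu>hat k..1} \<and>
                 f (xbar k + \<mu> *\<^sub>R (a - xbar k)) \<le> f (xbar k) - \<gamma>r * \<mu>\<^sup>2)
      in if \<exists>a \<mu>. ok a \<mu>
           then \<exists>a \<mu>. ok a \<mu> \<and> x (Suc k) = xbar k + \<mu> *\<^sub>R (a - xbar k) \<and> R k = {a} \<and>
                  \<mu>hat (Suc k) = \<mu>hat k
         else x (Suc k) = xbar k \<and> R k = {} \<and> \<mu>hat (Suc k) = \<theta>r * \<mu>hat k"
    and drop: "\<And>k. D k \<subseteq> {a \<in> Ak k.
        \<exists>h<length (cols k). a = cols_mult (cols k) (basis_vec h) \<and> ybar k h = 0}"
    and update: "\<And>k. Ak (Suc k) = (Ak k \<union> R k) - D k"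
      "\<And>k. y (Suc k) \<in> unit_simplex (card (Ak (Suc k)))"
      "\<And>k. x (Suc k) = cols_mult (cols (Suc k)) (y (Suc k))"

end

theory Submission
  imports Defs
begin

text \<open>
  Sufficient decrease in all phases makes \<open>f (x k)\<close> decrease to \<open>f x\<^sup>*\<close>, so the accepted refine steps
  tend to 0 and also \<open>xbar k\<close> tends to \<open>x\<^sup>*\<close>. When DF-SIMPLEX stops at \<open>ybar k\<close>, with pivot \<open>j\<close>, all its
  trial steps of length at most \<open>\<epsilon> k\<close> have failed. Writing \<open>g\<close> for the gradient at \<open>x\<^sup>*\<close>, failure towards
  the column \<open>a\<^sub>h\<close> gives \<open>g \<bullet> (a\<^sub>h - a\<^sub>j) \<ge> - o(1)\<close>, hence \<open>g \<bullet> (x\<^sup>* - a\<^sub>j) \<ge> - o(1)\<close> by averaging over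
  \<open>h\<close>; and failure away from a column \<open>a\<close> of positive weight gives \<open>g \<bullet> (a\<^sub>j - a) \<ge> - o(1)\<close>. So if
  \<open>g \<bullet> (a - x\<^sup>*) > 0\<close>, then eventually \<open>a\<close> has weight 0 and is dropped. It is not added again,
  since \<open>f\<close> does not decrease along short steps towards \<open>a\<close>.
\<close>

section \<open>First-order estimates\<close>

lemma GDERIV_along_line:
  assumes "GDERIV f (v + t *\<^sub>R d) :> g"
  shows "((\<lambda>s. f (v + s *\<^sub>R d)) has_real_derivative g \<bullet> d) (at t)"
proof -
  have "(f has_derivative (\<lambda>h. h \<bullet> g)) (at (v + t *\<^sub>R d))"
    using assms by (simp add: gderiv_def)
  moreover have "((\<lambda>s. v + s *\<^sub>R d) has_derivative (\<lambda>s. s *\<^sub>R d)) (at t)"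
    by (auto intro!: derivative_eq_intros)
  ultimately have "((\<lambda>s. f (v + s *\<^sub>R d)) has_derivative (\<lambda>s. (s *\<^sub>R d) \<bullet> g)) (at t)"
    by (rule has_derivative_compose[rotated])
  then show ?thesis
    by (rule has_derivative_imp_has_field_derivative) (simp add: inner_commute)
qed

text \<open>Mean value theorem on the segment from \<open>v\<close>, which stays in the ball around
  \<open>c\<close> where the gradient is \<open>e\<close>-close to \<open>g\<close>, followed by
  Cauchy-Schwarz. The slope \<open>g\<close> is fixed instead of being taken at \<open>v\<close>, so
  that one estimate serves a moving base point.\<close>

lemma linearization_error:
  assumes grad: "\<And>v. GDERIV f v :> gradf v"
    and near: "\<And>w. dist w c < r \<Longrightarrow> dist (gradf w) g \<le> e"
    and t: "0 < t" "dist v c + t * norm d < r"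
  shows "\<bar>f (v + t *\<^sub>R d) - f v - t * (g \<bullet> d)\<bar> \<le> t * (e * norm d)"
proof -
  obtain s where s: "0 < s" "s < t"
    "f (v + t *\<^sub>R d) - f (v + 0 *\<^sub>R d) = (t - 0) * (gradf (v + s *\<^sub>R d) \<bullet> d)"
    using MVT2[OF t(1), of "\<lambda>s. f (v + s *\<^sub>R d)" "\<lambda>s. gradf (v + s *\<^sub>R d) \<bullet> d"]
      GDERIV_along_line[OF grad] by blast
  have "dist (v + s *\<^sub>R d) c \<le> dist (v + s *\<^sub>R d) v + dist v c"
    by (rule dist_triangle)
  also have "\<dots> \<le> t * norm d + dist v c"
    using s by (simp add: dist_norm mult_right_mono)
  finally have "dist (gradf (v + s *\<^sub>R d)) g \<le> e"
    using t(2) by (intro near) simp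
  then have "\<bar>(gradf (v + s *\<^sub>R d) - g) \<bullet> d\<bar> \<le> e * norm d"
    by (intro order_trans[OF Cauchy_Schwarz_ineq2] mult_right_mono) (auto simp: dist_norm)
  then have "t * \<bar>(gradf (v + s *\<^sub>R d) - g) \<bullet> d\<bar> \<le> t * (e * norm d)"
    using t(1) by (intro mult_left_mono) auto
  moreover have "f (v + t *\<^sub>R d) - f v - t * (g \<bullet> d) = t * ((gradf (v + s *\<^sub>R d) - g) \<bullet> d)"
    using s(3) by (simp add: inner_diff_left algebra_simps)
  ultimately show ?thesis
    using t(1) by (simp add: abs_mult)
qed

section \<open>DF-SIMPLEX\<close>

lemma step_along_basis_diff_in_simplex_iff:
  assumes "w \<in> unit_simplex p" "i < p" "j < p" "i \<noteq> j"
  shows "step_along w \<alpha> (\<lambda>h. basis_vec i h - basis_vec j h) \<in> unit_simplex p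
    \<longleftrightarrow> - w i \<le> \<alpha> \<and> \<alpha> \<le> w j"
proof -
  have "(\<Sum>h<p. step_along w \<alpha> (\<lambda>h. basis_vec i h - basis_vec j h) h) = 1"
    using assms
    by (simp add: unit_simplex_def step_along_def basis_vec_def sum.distrib sum_subtractf
        flip: sum_distrib_left)
  \<comment> \<open>Only coordinates \<open>i\<close> and \<open>j\<close> change, to
    \<open>w i + \<alpha>\<close> and \<open>w j - \<alpha>\<close>.\<close>
  moreover have "(\<forall>h<p. 0 \<le> step_along w \<alpha> (\<lambda>h. basis_vec i h - basis_vec j h) h)
      \<longleftrightarrow> - w i \<le> \<alpha> \<and> \<alpha> \<le> w j" (is "?L \<longleftrightarrow> ?R")
  proof
    assume ?L
    from this[rule_format, OF assms(2)] this[rule_format, OF assms(3)] show ?R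
      using assms(4) by (auto simp: step_along_def basis_vec_def)
  next
    assume ?R
    then show ?L
      using assms by (auto simp: unit_simplex_def step_along_def basis_vec_def)
  qed
  moreover have "\<forall>h\<ge>p. step_along w \<alpha> (\<lambda>h. basis_vec i h - basis_vec j h) h = 0"
    using assms by (auto simp: unit_simplex_def step_along_def basis_vec_def)
  ultimately show ?thesis
    by (simp add: unit_simplex_def)
qed

lemma max_step_basis_diff:
  assumes "w \<in> unit_simplex p" "i < p" "j < p" "i \<noteq> j"
  shows "max_step p w (\<lambda>h. basis_vec i h - basis_vec j h) = w j"
proof -
  have "0 \<le> w i" "0 \<le> w j"
    using assms by (auto simp: unit_simplex_def)
  then show ?thesis
    unfolding max_step_def step_along_basis_diff_in_simplex_iff[OF assms]
    by (intro Greatest_equality) auto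
qed

text \<open>The three properties are a loop invariant: the body is entered only after the trial step
  has passed the decrease test.\<close>

lemma expand_result:
  assumes "expand \<phi> \<gamma> \<delta> z d b \<alpha> \<alpha>'" "0 < \<alpha>" "\<alpha> \<le> b" "suff_decrease \<phi> \<gamma> z \<alpha> d" "0 < \<delta>"
  shows "0 < \<alpha>' \<and> \<alpha>' \<le> b \<and> suff_decrease \<phi> \<gamma> z \<alpha>' d"
  using assms by induction auto

lemma line_search_basis_diff_cases:
  assumes "w \<in> unit_simplex p" "i < p" "j < p" "i \<noteq> j" "0 < \<delta>"
    and "line_search \<phi> p w (\<lambda>h. basis_vec i h - basis_vec j h) \<alpha>hat \<gamma> \<delta> \<alpha> d"
  obtains
    (forward) "d = (\<lambda>h. basis_vec i h - basis_vec j h)" "0 < \<alpha>" "\<alpha> \<le> w j"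
      "suff_decrease \<phi> \<gamma> w \<alpha> d"
  | (backward) "d = (\<lambda>h. basis_vec j h - basis_vec i h)" "0 < \<alpha>" "\<alpha> \<le> w i"
      "suff_decrease \<phi> \<gamma> w \<alpha> d"
  | (fail) "\<alpha> = 0"
      "0 < min (w j) \<alpha>hat \<Longrightarrow>
        \<not> suff_decrease \<phi> \<gamma> w (min (w j) \<alpha>hat) (\<lambda>h. basis_vec i h - basis_vec j h)"
      "0 < min (w i) \<alpha>hat \<Longrightarrow>
        \<not> suff_decrease \<phi> \<gamma> w (min (w i) \<alpha>hat) (\<lambda>h. basis_vec j h - basis_vec i h)"
proof -
  \<comment> \<open>Reversing the direction is swapping \<open>i\<close> and \<open>j\<close>, so
    one formula for the maximal step covers both searches.\<close>
  have neg: "(\<lambda>h. - (basis_vec i h - basis_vec j h)) = (\<lambda>h. basis_vec j h - basis_vec i h)"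
    by auto
  note ls = assms(6)[unfolded line_search_def Let_def neg max_step_basis_diff[OF assms(1-4)]
    max_step_basis_diff[OF assms(1,3,2) assms(4)[symmetric]]]
  consider
    (a) "0 < min (w j) \<alpha>hat"
      "suff_decrease \<phi> \<gamma> w (min (w j) \<alpha>hat) (\<lambda>h. basis_vec i h - basis_vec j h)"
  | (b) "\<not> (0 < min (w j) \<alpha>hat \<and>
      suff_decrease \<phi> \<gamma> w (min (w j) \<alpha>hat) (\<lambda>h. basis_vec i h - basis_vec j h))"
      "0 < min (w i) \<alpha>hat"
      "suff_decrease \<phi> \<gamma> w (min (w i) \<alpha>hat) (\<lambda>h. basis_vec j h - basis_vec i h)"
  | (c) "\<not> (0 < min (w j) \<alpha>hat \<and>
      suff_decrease \<phi> \<gamma> w (min (w j) \<alpha>hat) (\<lambda>h. basis_vec i h - basis_vec j h))"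
      "\<not> (0 < min (w i) \<alpha>hat \<and>
      suff_decrease \<phi> \<gamma> w (min (w i) \<alpha>hat) (\<lambda>h. basis_vec j h - basis_vec i h))"
    by blast
  then show thesis
  proof cases
    case a
    with ls have "d = (\<lambda>h. basis_vec i h - basis_vec j h)"
      and "expand \<phi> \<gamma> \<delta> w (\<lambda>h. basis_vec i h - basis_vec j h) (w j) (min (w j) \<alpha>hat) \<alpha>"
      by (simp_all only: if_True simp_thms)
    with expand_result[OF this(2) a(1) _ a(2) assms(5)] show thesis
      by (intro forward) auto
  next
    case b
    with ls have "d = (\<lambda>h. basis_vec j h - basis_vec i h)"
      and "expand \<phi> \<gamma> \<delta> w (\<lambda>h. basis_vec j h - basis_vec i h) (w i) (min (w i) \<alpha>hat) \<alpha>"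
      by (simp_all only: if_False if_True simp_thms)
    with expand_result[OF this(2) b(2) _ b(3) assms(5)] show thesis
      by (intro backward) auto
  next
    case c
    with ls have "\<alpha> = 0"
      by (simp only: if_False simp_thms)
    with c show thesis
      by (intro fail) blast+
  qed
qed

lemma suff_decrease_imp_le:
  assumes "suff_decrease \<phi> \<gamma> z \<alpha> d" "0 \<le> \<gamma>"
  shows "\<phi> (step_along z \<alpha> d) \<le> \<phi> z"
proof -
  have "0 \<le> \<gamma> * \<alpha>\<^sup>2"
    using assms(2) by simp
  with assms(1) show ?thesis
    by (simp add: suff_decrease_def)
qed

lemma line_search_descent:
  assumes "w \<in> unit_simplex p" "i < p" "j < p" "i \<noteq> j" "0 < \<delta>" "0 \<le> \<gamma>"
    and "line_search \<phi> p w (\<lambda>h. basis_vec i h - basis_vec j h) \<alpha>hat \<gamma> \<delta> \<alpha> d"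
  shows "step_along w \<alpha> d \<in> unit_simplex p \<and> \<phi> (step_along w \<alpha> d) \<le> \<phi> w"
proof -
  have nonneg: "0 \<le> w i" "0 \<le> w j"
    using assms by (auto simp: unit_simplex_def)
  show ?thesis
    using assms(1-5,7)
  proof (cases rule: line_search_basis_diff_cases)
    case forward
    then show ?thesis
      using step_along_basis_diff_in_simplex_iff[OF assms(1-4)] nonneg
        suff_decrease_imp_le[OF _ assms(6)] by auto
  next
    case backward
    then show ?thesis
      using step_along_basis_diff_in_simplex_iff[OF assms(1,3,2) assms(4)[symmetric]] nonneg
        suff_decrease_imp_le[OF _ assms(6)] by auto
  next
    case fail
    then show ?thesis
      using assms(1) by (simp add: step_along_def)
  qed
qed

section \<open>Iterations and finite runs of DF-SIMPLEX\<close>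

lemma df_simplex_iteration_descent:
  assumes it: "df_simplex_iteration \<phi> p \<epsilon> \<tau> \<theta> \<gamma> \<delta> y \<alpha>hat j \<alpha> d z \<alpha>hat'"
    and "y \<in> unit_simplex p" "0 < \<delta>" "0 \<le> \<gamma>" "i \<le> p"
  shows "z i \<in> unit_simplex p \<and> \<phi> (z i) \<le> \<phi> y"
  using \<open>i \<le> p\<close>
proof (induction i)
  case 0
  then show ?case
    using assms by (simp add: df_simplex_iteration_def)
next
  case (Suc i)
  then have IH: "z i \<in> unit_simplex p" "\<phi> (z i) \<le> \<phi> y"
    by auto
  from it Suc.prems have "j < p" "z (Suc i) = step_along (z i) (\<alpha> i) (d i)"
    and alt: "if i = j then \<alpha> i = 0 \<and> d i = (\<lambda>_. 0)
       else line_search \<phi> p (z i) (\<lambda>h. basis_vec i h - basis_vec j h) (\<alpha>hat i) \<gamma> \<delta> (\<alpha> i) (d i) \<and>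
            \<alpha>hat' i = (if \<alpha> i = 0 then max (\<theta> * \<alpha>hat i) \<epsilon> else \<alpha> i)"
    by (simp_all add: df_simplex_iteration_def)
  show ?case
  proof (cases "i = j")
    case True
    then show ?thesis
      using alt \<open>z (Suc i) = _\<close> IH by (simp add: step_along_def)
  next
    case False
    with alt have
      "line_search \<phi> p (z i) (\<lambda>h. basis_vec i h - basis_vec j h) (\<alpha>hat i) \<gamma> \<delta> (\<alpha> i) (d i)"
      by simp
    from line_search_descent[OF IH(1) _ \<open>j < p\<close> False assms(3,4) this] Suc.prems
    show ?thesis
      using \<open>z (Suc i) = _\<close> IH(2) by simp
  qed
qed

text \<open>Otherwise the largest weight would be nonpositive and the weights could not sum to 1.
  Thus the pivot has weight to give away, and every search towards another column tests a step of
  positive length.\<close>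

lemma simplex_near_max_pos:
  assumes "w \<in> unit_simplex p" "0 < \<tau>" "\<tau> * Max (w ` {..<p}) \<le> w j"
  shows "0 < w j"
proof (rule ccontr)
  assume "\<not> 0 < w j"
  with assms have "\<tau> * Max (w ` {..<p}) \<le> 0"
    by simp
  with assms(2) have "Max (w ` {..<p}) \<le> 0"
    by (simp add: mult_le_0_iff)
  then have "w i \<le> 0" if "i < p" for i
    using that by (meson Max_ge finite_imageI finite_lessThan imageI lessThan_iff order_trans)
  then have "(\<Sum>i<p. w i) \<le> 0"
    by (intro sum_nonpos) auto
  with assms(1) show False
    by (simp add: unit_simplex_def)
qed

lemma df_simplex_iteration_null:
  assumes it: "df_simplex_iteration \<phi> p \<epsilon> \<tau> \<theta> \<gamma> \<delta> y \<alpha>hat j \<alpha> d z \<alpha>hat'"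
    and null: "\<forall>i<p. i \<noteq> j \<longrightarrow> \<alpha> i = 0" and "i \<le> p"
  shows "z i = y"
  using \<open>i \<le> p\<close>
proof (induction i)
  case 0
  then show ?case
    using it by (simp add: df_simplex_iteration_def)
next
  case (Suc i)
  with it have "z (Suc i) = step_along (z i) (\<alpha> i) (d i)" "i = j \<longrightarrow> \<alpha> i = 0"
    by (auto simp: df_simplex_iteration_def)
  with null Suc show ?case
    by (cases "i = j") (auto simp: step_along_def)
qed

text \<open>What the stopping iteration leaves behind: from the single point \<open>w\<close>, all
  trial steps in both directions have failed. The lengths are the tentative step \<epsilon> capped
  by the weight of the coordinate that shrinks.\<close>

definition df_simplex_stationary ::
  "(rvec \<Rightarrow> real) \<Rightarrow> nat \<Rightarrow> real \<Rightarrow> real \<Rightarrow> nat \<Rightarrow> rvec \<Rightarrow> bool"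
where
  "df_simplex_stationary \<phi> p \<epsilon> \<gamma> j w \<longleftrightarrow> j < p \<and> 0 < w j \<and> (\<forall>i<p. i \<noteq> j \<longrightarrow>
     \<not> suff_decrease \<phi> \<gamma> w (min (w j) \<epsilon>) (\<lambda>h. basis_vec i h - basis_vec j h) \<and>
     (0 < w i \<longrightarrow>
       \<not> suff_decrease \<phi> \<gamma> w (min (w i) \<epsilon>) (\<lambda>h. basis_vec j h - basis_vec i h)))"

text \<open>With all steps zero, each intermediate point \<open>z i\<close> is still
  \<open>y\<close>, so all line searches start there. A zero step is possible only in the failing
  case of the search.\<close>

lemma df_simplex_iteration_stop:
  assumes it: "df_simplex_iteration \<phi> p \<epsilon> \<tau> \<theta> \<gamma> \<delta> y \<alpha>hat j \<alpha> d z \<alpha>hat'"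
    and null: "\<forall>i<p. i \<noteq> j \<longrightarrow> \<alpha> i = 0" and \<alpha>hat: "\<forall>i<p. \<alpha>hat i = \<epsilon>"
    and y: "y \<in> unit_simplex p" and "0 < \<delta>" "0 < \<tau>" "0 < \<epsilon>"
  shows "df_simplex_stationary \<phi> p \<epsilon> \<gamma> j y"
proof -
  from it have j: "j < p" "\<tau> * Max (y ` {..<p}) \<le> y j"
    by (simp_all add: df_simplex_iteration_def)
  have "0 < y j"
    using simplex_near_max_pos[OF y \<open>0 < \<tau>\<close> j(2)] .
  moreover have "\<not> suff_decrease \<phi> \<gamma> y (min (y j) \<epsilon>) (\<lambda>h. basis_vec i h - basis_vec j h) \<and>
     (0 < y i \<longrightarrow>
       \<not> suff_decrease \<phi> \<gamma> y (min (y i) \<epsilon>) (\<lambda>h. basis_vec j h - basis_vec i h))"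
    if i: "i < p" "i \<noteq> j" for i
  proof -
    have "z i = y"
      using df_simplex_iteration_null[OF it null] i by simp
    with it i \<alpha>hat
    have "line_search \<phi> p y (\<lambda>h. basis_vec i h - basis_vec j h) \<epsilon> \<gamma> \<delta> (\<alpha> i) (d i)"
      by (auto simp: df_simplex_iteration_def)
    with y i(1) j(1) i(2) \<open>0 < \<delta>\<close> show ?thesis
      by (cases rule: line_search_basis_diff_cases)
         (use null i \<open>0 < y j\<close> \<open>0 < \<epsilon>\<close> in auto)
  qed
  ultimately show ?thesis
    using j(1) by (simp add: df_simplex_stationary_def)
qed

lemma df_simplex_returns_result:
  assumes ret: "df_simplex_returns \<phi> p \<epsilon> \<tau> \<theta> \<gamma> \<delta> \<alpha>hat0 y0 ybar"
    and "y0 \<in> unit_simplex p" "0 < \<delta>" "0 < \<tau>" "0 \<le> \<gamma>" "0 < \<epsilon>"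
  shows "ybar \<in> unit_simplex p" "\<phi> ybar \<le> \<phi> y0" "\<exists>j. df_simplex_stationary \<phi> p \<epsilon> \<gamma> j ybar"
proof -
  from ret obtain L y \<alpha>hat j \<alpha> d z where y0: "y 0 = y0" and yL: "ybar = y L"
    and it: "\<And>l. l \<le> L \<Longrightarrow> df_simplex_iteration \<phi> p \<epsilon> \<tau> \<theta> \<gamma> \<delta> (y l) (\<alpha>hat l) (j l) (\<alpha> l) (d l) (z l)
                   (\<alpha>hat (Suc l))"
    and ySuc: "\<And>l. l \<le> L \<Longrightarrow> y (Suc l) = z l p"
    and stop: "\<forall>i<p. \<alpha>hat L i = \<epsilon>" "\<forall>i<p. i \<noteq> j L \<longrightarrow> \<alpha> L i = 0"
    unfolding df_simplex_returns_def Let_def by blast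
  \<comment> \<open>The iterations before \<open>L\<close> give the descent. Iteration
    \<open>L\<close> is also executed, but contributes only its failed searches: the returned point
    is its start \<open>y L\<close>.\<close>
  have inv: "y l \<in> unit_simplex p \<and> \<phi> (y l) \<le> \<phi> y0" if "l \<le> L" for l
    using that
  proof (induction l)
    case 0
    then show ?case
      using y0 assms(2) by simp
  next
    case (Suc l)
    then show ?case
      using df_simplex_iteration_descent[OF it[of l] _ assms(3,5) order_refl] ySuc[of l]
      by fastforce
  qed
  then show "ybar \<in> unit_simplex p" "\<phi> ybar \<le> \<phi> y0"
    using yL by auto
  then show "\<exists>j. df_simplex_stationary \<phi> p \<epsilon> \<gamma> j ybar"
    using df_simplex_iteration_stop[OF it[of L] stop(2,1) _ assms(3,4,6)] yL by auto
qed

section \<open>Convex combinations of columns\<close>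

lemma cols_mult_basis_vec:
  assumes "h < length cs"
  shows "cols_mult cs (basis_vec h) = cs ! h"
proof -
  have "cols_mult cs (basis_vec h) = (\<Sum>i<length cs. if i = h then cs ! i else 0)"
    unfolding cols_mult_def basis_vec_def by (intro sum.cong) auto
  with assms show ?thesis
    by simp
qed

lemma cols_mult_step_along_basis_diff:
  assumes "i < length cs" "j < length cs"
  shows "cols_mult cs (step_along w \<alpha> (\<lambda>h. basis_vec i h - basis_vec j h))
    = cols_mult cs w + \<alpha> *\<^sub>R (cs ! i - cs ! j)"
proof -
  have "cols_mult cs (step_along w \<alpha> (\<lambda>h. basis_vec i h - basis_vec j h))
    = cols_mult cs w + \<alpha> *\<^sub>R (cols_mult cs (basis_vec i) - cols_mult cs (basis_vec j))"
    by (simp add: cols_mult_def step_along_def scaleR_sum_right algebra_simps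
        sum.distrib sum_subtractf)
  with assms show ?thesis
    by (simp add: cols_mult_basis_vec)
qed

lemma cols_mult_in_convex_hull:
  assumes "w \<in> unit_simplex (length cs)"
  shows "cols_mult cs w \<in> convex hull (set cs)"
  unfolding cols_mult_def
  by (rule convex_sum) (use assms in \<open>auto simp: unit_simplex_def hull_inc\<close>)

text \<open>A halfspace is convex, so it contains the hull of the columns once it contains the
  columns.\<close>

lemma inner_cols_mult_lower_bound:
  assumes "w \<in> unit_simplex (length cs)" "\<And>i. i < length cs \<Longrightarrow> c \<le> g \<bullet> (cs ! i - b)"
  shows "c \<le> g \<bullet> (cols_mult cs w - b)"
proof -
  have "set cs \<subseteq> {v. c + g \<bullet> b \<le> g \<bullet> v}"
    using assms(2) by (force simp: in_set_conv_nth inner_diff_right)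
  then have "convex hull (set cs) \<subseteq> {v. c + g \<bullet> b \<le> g \<bullet> v}"
    by (rule hull_minimal) (rule convex_halfspace_ge)
  with cols_mult_in_convex_hull[OF assms(1)] show ?thesis
    by (auto simp: inner_diff_right)
qed

text \<open>The bound is the diameter plus 1, which stays positive even for a single point and may
  therefore be divided by.\<close>

lemma finite_hull_diff_bounded:
  fixes A :: "'a::euclidean_space set"
  assumes "finite A"
  obtains B where "0 < B" "\<And>u v. u \<in> convex hull A \<Longrightarrow> v \<in> convex hull A \<Longrightarrow> norm (u - v) \<le> B"
proof
  have "bounded (convex hull A)"
    using assms by (simp add: bounded_convex_hull finite_imp_bounded)
  then show "norm (u - v) \<le> 1 + diameter (convex hull A)"
    if "u \<in> convex hull A" "v \<in> convex hull A" for u v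
    using diameter_bounded_bound[OF _ that] by (simp add: dist_norm)
  show "0 < 1 + diameter (convex hull A)"
    using diameter_ge_0[OF \<open>bounded _\<close>] by simp
qed

section \<open>Runs of ORD\<close>

context ORD_run
begin

section \<open>Invariants of a run\<close>

lemma Ak_subset: "Ak k \<subseteq> A"
proof (induction k)
  case 0
  show ?case by (fact init)
next
  case (Suc k)
  have "R k \<subseteq> A"
    using refine[of k] by (auto simp: Let_def split: if_splits)
  with Suc show ?case
    using update(1)[of k] by auto
qed

lemma length_cols: "length (cols k) = card (Ak k)"
  using columns[of k] distinct_card by metis

lemma y_in_simplex: "y k \<in> unit_simplex (length (cols k))"
proof (cases k)
  case 0
  then show ?thesis
    using init(2) by (auto simp: unit_simplex_def basis_vec_def)
next
  case (Suc l)
  then show ?thesis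
    using update(2)[of l] by (simp add: length_cols)
qed

lemma x_eq_cols_mult: "x k = cols_mult (cols k) (y k)"
proof (cases k)
  case 0
  then show ?thesis
    using init(2) by (auto simp: cols_mult_basis_vec)
next
  case (Suc l)
  then show ?thesis
    using update(3)[of l] by simp
qed

text \<open>With a single column DF-SIMPLEX is skipped and \<open>ybar k = y k\<close>, hence the
  restriction on the last claim.\<close>

lemma ybar_result:
  shows "ybar k \<in> unit_simplex (length (cols k))" "f (xbar k) \<le> f (x k)"
    "length (cols k) \<noteq> 1 \<Longrightarrow>
      \<exists>j. df_simplex_stationary (\<lambda>v. f (cols_mult (cols k) v)) (length (cols k)) (\<epsilon> k) \<gamma> j (ybar k)"
proof -
  have "ybar k \<in> unit_simplex (length (cols k)) \<and> f (xbar k) \<le> f (x k) \<and>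
    (length (cols k) \<noteq> 1 \<longrightarrow> (\<exists>j. df_simplex_stationary (\<lambda>v. f (cols_mult (cols k) v))
      (length (cols k)) (\<epsilon> k) \<gamma> j (ybar k)))"
  proof (cases "length (cols k) = 1")
    case True
    then have "ybar k = y k"
      using optimize(1)[of k] by (simp add: length_cols)
    with True show ?thesis
      using y_in_simplex[of k] optimize(2)[of k] x_eq_cols_mult[of k] by simp
  next
    case False
    then obtain \<alpha>hat0 where
      "df_simplex_returns (\<lambda>v. f (cols_mult (cols k) v)) (length (cols k)) (\<epsilon> k) \<tau> \<theta> \<gamma> \<delta>
          \<alpha>hat0 (y k) (ybar k)"
      using optimize(1)[of k] by (auto simp: length_cols)
    from df_simplex_returns_result[OF this y_in_simplex] df_params eps(1)[of k] False
    show ?thesis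
      using optimize(2)[of k] x_eq_cols_mult[of k] by simp
  qed
  then show "ybar k \<in> unit_simplex (length (cols k))" "f (xbar k) \<le> f (x k)"
    "length (cols k) \<noteq> 1 \<Longrightarrow>
      \<exists>j. df_simplex_stationary (\<lambda>v. f (cols_mult (cols k) v)) (length (cols k)) (\<epsilon> k) \<gamma> j (ybar k)"
    by auto
qed

lemma xbar_in_hull: "xbar k \<in> convex hull A"
  using cols_mult_in_convex_hull[OF ybar_result(1)[of k]] optimize(2)[of k]
    hull_mono[OF Ak_subset[of k]] columns(2)[of k] by auto

lemma mu_hat_pos: "0 < \<mu>hat k"
proof (induction k)
  case 0
  show ?case by (fact ord_params)
next
  case (Suc k)
  with refine[of k] ord_params show ?case
    by (auto simp: Let_def split: if_splits)
qed

lemma refine_cases: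
  obtains (add) a \<mu> where "a \<in> A" "a \<notin> Ak k" "0 < \<mu>" "R k = {a}"
      "x (Suc k) = xbar k + \<mu> *\<^sub>R (a - xbar k)" "f (x (Suc k)) \<le> f (xbar k) - \<gamma>r * \<mu>\<^sup>2"
  | (keep) "R k = {}" "x (Suc k) = xbar k"
proof (cases "\<exists>a \<mu>. a \<in> A - Ak k \<and> \<mu> \<in> {\<mu>hat k..1} \<and>
                 f (xbar k + \<mu> *\<^sub>R (a - xbar k)) \<le> f (xbar k) - \<gamma>r * \<mu>\<^sup>2")
  case True
  with refine[of k] obtain a \<mu> where "a \<in> A - Ak k" "\<mu> \<in> {\<mu>hat k..1}"
    "f (xbar k + \<mu> *\<^sub>R (a - xbar k)) \<le> f (xbar k) - \<gamma>r * \<mu>\<^sup>2"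
    "x (Suc k) = xbar k + \<mu> *\<^sub>R (a - xbar k)" "R k = {a}"
    unfolding Let_def by (simp only: if_True) blast
  then show thesis
    using mu_hat_pos[of k] by (intro add[of a \<mu>]) auto
next
  case False
  with refine[of k] show thesis
    unfolding Let_def by (intro keep) (simp_all only: if_False simp_thms)
qed

section \<open>Vanishing refine steps and the limit of \<open>xbar\<close>\<close>

lemma small_refine_step:
  assumes "continuous_on UNIV f" "x \<longlonglongrightarrow> xstar" "0 < c"
  shows "\<forall>\<^sub>F k in sequentially. \<forall>\<mu>\<ge>0. f (x (Suc k)) \<le> f (xbar k) - \<gamma>r * \<mu>\<^sup>2 \<longrightarrow> \<mu> < c"
proof -
  have "isCont f xstar"
    using assms(1) by (simp add: continuous_on_eq_continuous_at)
  then have "(\<lambda>k. f (x k)) \<longlonglongrightarrow> f xstar"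
    using assms(2) by (rule isCont_tendsto_compose)
  from tendsto_diff[OF this LIMSEQ_Suc[OF this]]
  have "(\<lambda>k. f (x k) - f (x (Suc k))) \<longlonglongrightarrow> 0"
    by simp
  moreover have "0 < \<gamma>r * c\<^sup>2"
    using assms(3) ord_params by simp
  \<comment> \<open>A refine step \<mu> costs at least \<open>\<gamma>r * \<mu>\<^sup>2\<close>
    between \<open>f (xbar k)\<close>, which is at most \<open>f (x k)\<close>, and
    \<open>f (x (Suc k))\<close>; these values of \<open>f\<close> along \<open>x\<close> merge in
    the limit.\<close>
  ultimately have "\<forall>\<^sub>F k in sequentially. f (x k) - f (x (Suc k)) < \<gamma>r * c\<^sup>2"
    by (rule order_tendstoD)
  then show ?thesis
  proof eventually_elim
    case (elim k)
    show ?case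
    proof (intro allI impI)
      fix \<mu> :: real
      assume \<mu>: "\<mu> \<ge> 0" "f (x (Suc k)) \<le> f (xbar k) - \<gamma>r * \<mu>\<^sup>2"
      with elim ybar_result(2)[of k] have "\<gamma>r * \<mu>\<^sup>2 < \<gamma>r * c\<^sup>2"
        by linarith
      then have "\<mu>\<^sup>2 < c\<^sup>2"
        using ord_params by simp
      then show "\<mu> < c"
        using assms(3) by (auto intro: power_less_imp_less_base)
    qed
  qed
qed

lemma xbar_tendsto:
  assumes "finite A" "continuous_on UNIV f" "x \<longlonglongrightarrow> xstar"
  shows "xbar \<longlonglongrightarrow> xstar"
proof -
  obtain B where B: "0 < B"
    "\<And>u v. u \<in> convex hull A \<Longrightarrow> v \<in> convex hull A \<Longrightarrow> norm (u - v) \<le> B"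
    using finite_hull_diff_bounded[OF assms(1)] by blast
  have "(\<lambda>k. x (Suc k) - xbar k) \<longlonglongrightarrow> 0"
  proof (rule tendstoI)
    fix e :: real
    assume "0 < e"
    \<comment> \<open>A refine step \<mu> moves the point by at most
      \<open>\<mu> * B\<close>.\<close>
    then have "0 < e / B"
      using B(1) by simp
    from small_refine_step[OF assms(2,3) this]
    show "\<forall>\<^sub>F k in sequentially. dist (x (Suc k) - xbar k) 0 < e"
    proof eventually_elim
      case (elim k)
      show ?case
      proof (cases rule: refine_cases[of k])
        case (add a \<mu>)
        with elim have "\<mu> * B < e"
          using B(1) by (simp add: pos_less_divide_eq)
        moreover have "\<mu> * norm (a - xbar k) \<le> \<mu> * B"
          using add B(2)[OF hull_inc xbar_in_hull] by (intro mult_left_mono) auto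
        ultimately have "\<mu> * norm (a - xbar k) < e"
          by linarith
        with add show ?thesis
          by simp
      next
        case keep
        then show ?thesis
          using \<open>0 < e\<close> by simp
      qed
    qed
  qed
  from tendsto_diff[OF LIMSEQ_Suc[OF assms(3)] this] show ?thesis
    by simp
qed

section \<open>Atoms with positive directional derivative are eventually absent\<close>

lemma eventually_not_in_Ak:
  assumes "finite A"
    and grad: "\<And>v. GDERIV f v :> gradf v" and cont: "continuous_on UNIV gradf"
    and D_eq: "\<And>k. D k = {a \<in> Ak k.
      \<exists>h<length (cols k). a = cols_mult (cols k) (basis_vec h) \<and> ybar k h = 0}"
    and lim: "x \<longlonglongrightarrow> xstar"
    and "a \<in> A" and pos: "0 < gradf xstar \<bullet> (a - xstar)"
  shows "\<forall>\<^sub>F k in sequentially. a \<notin> Ak k"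
proof -
  define g where "g = gradf xstar"
  define \<eta> where "\<eta> = g \<bullet> (a - xstar)"
  have \<eta>: "0 < \<eta>"
    using pos by (simp add: \<eta>_def g_def)
  obtain B where B: "0 < B"
    "\<And>u v. u \<in> convex hull A \<Longrightarrow> v \<in> convex hull A \<Longrightarrow> norm (u - v) \<le> B"
    using finite_hull_diff_bounded[OF assms(1)] by blast
  \<comment> \<open>Two failed-step bounds will be added, each losing \<open>e + e * B\<close>;
    their total loss is then exactly \<open>\<eta> / 2\<close>, the gap left by \<open>far\<close>
    below.\<close>
  define e where "e = \<eta> / (4 * (1 + B))"
  have "4 * (1 + B) * e = \<eta>"
    using B(1) by (simp add: e_def)
  then have e: "4 * (e + e * B) = \<eta>" "0 < e"
    using \<eta> B(1) by (simp add: algebra_simps, simp add: e_def)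
  have eB: "0 < e * B"
    using e B by simp
  have "isCont gradf xstar"
    using cont by (simp add: continuous_on_eq_continuous_at)
  then obtain r where r: "0 < r" "\<And>w. dist w xstar < r \<Longrightarrow> dist (gradf w) g \<le> e"
    using e(2) unfolding continuous_at_eps_delta g_def by (meson less_imp_le)
  \<comment> \<open>The radius \<open>r\<close> is split in half between the distance of the base
    point from \<open>xstar\<close> and the length of the step.\<close>
  have linear: "\<bar>f (v + t *\<^sub>R d) - f v - t * (g \<bullet> d)\<bar> \<le> t * (e * B)"
    if "0 < t" "t * B < r / 2" "dist v xstar < r / 2" "norm d \<le> B" for v t d
  proof -
    have "t * norm d \<le> t * B" and scaled: "t * (e * norm d) \<le> t * (e * B)"
      using that e(2) by (auto intro!: mult_left_mono)
    with that have "dist v xstar + t * norm d < r"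
      by linarith
    with that(1) have "\<bar>f (v + t *\<^sub>R d) - f v - t * (g \<bullet> d)\<bar> \<le> t * (e * norm d)"
      by (intro linearization_error[OF grad r(2)]) auto
    with scaled show ?thesis by linarith
  qed
  have contf: "continuous_on UNIV f"
    using grad by (auto simp: gderiv_def continuous_on_eq_continuous_at
        intro: has_derivative_continuous)
  have lim': "xbar \<longlonglongrightarrow> xstar"
    by (rule xbar_tendsto[OF assms(1) contf lim])
  have ev_xbar: "\<forall>\<^sub>F k in sequentially. dist (xbar k) xstar < r / 2"
    using lim' r(1) by (intro tendstoD) auto
  have "(\<lambda>k. g \<bullet> (xbar k - xstar)) \<longlonglongrightarrow> g \<bullet> (xstar - xstar)"
    by (intro tendsto_intros lim')
  then have ev_inner: "\<forall>\<^sub>F k in sequentially. g \<bullet> (xbar k - xstar) < \<eta> / 2"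
    using \<eta> by (intro order_tendstoD) auto
  have "(\<lambda>k. \<epsilon> k * B) \<longlonglongrightarrow> 0 * B" "(\<lambda>k. \<gamma> * \<epsilon> k) \<longlonglongrightarrow> \<gamma> * 0"
    by (intro tendsto_intros eps)+
  \<comment> \<open>The first bound keeps trial steps inside the ball; the second absorbs the term
    \<open>\<gamma> * t\<^sup>2\<close> after division by \<open>t\<close>.\<close>
  then have ev_eps: "\<forall>\<^sub>F k in sequentially. \<epsilon> k * B < r / 2"
    "\<forall>\<^sub>F k in sequentially. \<gamma> * \<epsilon> k < e"
    using r(1) e(2) by (auto intro!: order_tendstoD)
  have "0 < r / (2 * B)"
    using r(1) B(1) by simp
  note ev_mu = small_refine_step[OF contf lim this]
  \<comment> \<open>An atom is in \<open>Ak (Suc k)\<close> only if it was just added or survived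
    the drop; both are excluded for large \<open>k\<close>, whether or not \<open>a\<close> was
    present before.\<close>
  have "\<forall>\<^sub>F k in sequentially. a \<notin> Ak (Suc k)"
    using ev_xbar ev_inner ev_eps ev_mu
  proof eventually_elim
    case (elim k)
    have far: "g \<bullet> (xbar k - a) < - \<eta> / 2"
      using elim(2) by (simp add: \<eta>_def inner_diff_right)
    \<comment> \<open>Adding \<open>a\<close> would need a decrease along a short step, so a slope
      at most \<open>e * B\<close>, which is below \<open>\<eta> / 4\<close>; the slope towards
      \<open>a\<close> exceeds \<open>\<eta> / 2\<close>.\<close>
    have "a \<notin> R k"
    proof (cases rule: refine_cases[of k])
      case (add b \<mu>)
      show ?thesis
      proof
        assume "a \<in> R k"
        with add have "b = a" by simp
        have "\<mu> < r / (2 * B)"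
          using elim(5) add(3,6) by simp
        then have "\<mu> * B < r / 2"
          using B(1) by (simp add: field_simps)
        moreover have "norm (a - xbar k) \<le> B"
          using B(2)[OF hull_inc[OF \<open>a \<in> A\<close>] xbar_in_hull] .
        ultimately
        have "\<bar>f (x (Suc k)) - f (xbar k) - \<mu> * (g \<bullet> (a - xbar k))\<bar> \<le> \<mu> * (e * B)"
          using linear[OF add(3) _ elim(1)] add(5) \<open>b = a\<close> by simp
        moreover have "0 \<le> \<gamma>r * \<mu>\<^sup>2"
          using ord_params by simp
        ultimately have "\<mu> * (g \<bullet> (a - xbar k)) \<le> \<mu> * (e * B)"
          using add(6) by linarith
        then have "g \<bullet> (a - xbar k) \<le> e * B"
          using add(3) by simp
        with far e eB \<eta> show False
          by (simp add: inner_diff_right)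
      qed
    qed simp
    moreover have "a \<in> D k" if "a \<in> Ak k"
    proof -
      let ?cs = "cols k" and ?w = "ybar k"
      let ?p = "length ?cs" and ?\<phi> = "\<lambda>v. f (cols_mult ?cs v)"
      from that obtain i where i: "i < ?p" "?cs ! i = a"
        using columns(2)[of k] by (metis in_set_conv_nth)
      note w = ybar_result(1)[of k] and xbar = optimize(2)[of k]
      have "?p \<noteq> 1"
      proof
        assume "?p = 1"
        with i have "xbar k = a"
          using w xbar by (simp add: unit_simplex_def cols_mult_def)
        with far \<eta> show False by simp
      qed
      from ybar_result(3)[OF this] obtain j where
        j: "df_simplex_stationary ?\<phi> ?p (\<epsilon> k) \<gamma> j ?w" by blast
      then have "j < ?p" "0 < ?w j"
        by (auto simp: df_simplex_stationary_def)
      have hull: "?cs ! h \<in> convex hull A" if "h < ?p" for h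
        using that columns(2)[of k] Ak_subset[of k] nth_mem[OF that] by (auto intro: hull_inc)
      \<comment> \<open>A failed trial step \<open>t\<close> moving weight from column
        \<open>l\<close> to column \<open>h\<close> lowers \<open>f\<close> by less than
        \<open>\<gamma> * t\<^sup>2\<close>. Compare with the linearization and divide by
        \<open>t\<close>; below, \<open>s\<close> is the weight of \<open>l\<close>.\<close>
      have failed: "- (e + e * B) \<le> g \<bullet> (?cs ! h - ?cs ! l)"
        if "h < ?p" "l < ?p" "0 < s"
          "\<not> suff_decrease ?\<phi> \<gamma> ?w (min s (\<epsilon> k)) (\<lambda>q. basis_vec h q - basis_vec l q)"
        for h l s
      proof -
        define t where "t = min s (\<epsilon> k)"
        have t: "0 < t" "t \<le> \<epsilon> k"
          using that(3) eps(1)[of k] by (auto simp: t_def)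
        then have "t * B \<le> \<epsilon> k * B" "\<gamma> * t \<le> \<gamma> * \<epsilon> k"
          using B(1) df_params by auto
        then have tB: "t * B < r / 2" and \<gamma>t: "\<gamma> * t \<le> e"
          using elim by linarith+
        have "f (xbar k) - \<gamma> * t\<^sup>2 < f (xbar k + t *\<^sub>R (?cs ! h - ?cs ! l))"
          using that xbar
          by (simp add: suff_decrease_def t_def cols_mult_step_along_basis_diff)
        with linear[OF t(1) tB elim(1) B(2)[OF hull hull], OF that(1,2)]
        have "0 \<le> t * (g \<bullet> (?cs ! h - ?cs ! l)) + t * (e * B) + \<gamma> * t\<^sup>2"
          by linarith
        also have "\<dots> = t * (g \<bullet> (?cs ! h - ?cs ! l) + e * B + \<gamma> * t)"
          by (simp add: algebra_simps power2_eq_square)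
        finally have "0 \<le> g \<bullet> (?cs ! h - ?cs ! l) + e * B + \<gamma> * t"
          using t(1) by (simp add: zero_le_mult_iff)
        with \<gamma>t show ?thesis by linarith
      qed
      \<comment> \<open>The pivot itself, where the difference is 0, is included because the bound
        is next averaged over all columns.\<close>
      have "- (e + e * B) \<le> g \<bullet> (?cs ! h - ?cs ! j)" if "h < ?p" for h
      proof (cases "h = j")
        case True
        then show ?thesis
          using e(2) eB by simp
      next
        case False
        then show ?thesis
          using failed[OF that \<open>j < ?p\<close> \<open>0 < ?w j\<close>] j that
          by (auto simp: df_simplex_stationary_def)
      qed
      then have towards: "- (e + e * B) \<le> g \<bullet> (xbar k - ?cs ! j)"
        unfolding xbar by (rule inner_cols_mult_lower_bound[OF w])
      have "?w i = 0"
      proof (rule ccontr)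
        \<comment> \<open>With positive weight on \<open>a\<close>, the search back to the pivot
          tests a genuine step, and its failure gives the second bound.\<close>
        assume "?w i \<noteq> 0"
        with w i have "0 < ?w i"
          by (auto simp: unit_simplex_def order_less_le)
        have "- (e + e * B) \<le> g \<bullet> (?cs ! j - a)"
        proof (cases "i = j")
          case True
          then show ?thesis
            using i e(2) eB by simp
        next
          case False
          then show ?thesis
            using failed[OF \<open>j < ?p\<close> i(1) \<open>0 < ?w i\<close>] j i \<open>0 < ?w i\<close>
            by (auto simp: df_simplex_stationary_def)
        qed
        with towards far e(1) show False
          by (simp add: inner_diff_right)
      qed
      \<comment> \<open>The prescribed drop rule enters here: an atom of weight 0 is certain to be
        dropped.\<close>
      with that i show ?thesis
        by (auto simp: D_eq cols_mult_basis_vec intro!: exI[of _ i])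
    qed
    ultimately show ?case
      using update(1)[of k] by auto
  qed
  then show ?thesis
    by (rule eventually_sequentially_Suc[THEN iffD1])
qed

end

theorem theorem4:
  fixes f :: "real ^ 'n \<Rightarrow> real"
    and gradf :: "real ^ 'n \<Rightarrow> real ^ 'n"
    and A :: "(real ^ 'n) set"
    and \<tau> \<theta> \<gamma> \<delta> \<theta>r \<gamma>r :: real
    and \<epsilon> \<mu>hat :: "nat \<Rightarrow> real"
    and Ak R D :: "nat \<Rightarrow> (real ^ 'n) set"
    and cols :: "nat \<Rightarrow> (real ^ 'n) list"
    and x xbar :: "nat \<Rightarrow> real ^ 'n"
    and y ybar :: "nat \<Rightarrow> rvec"
    and xstar :: "real ^ 'n"
  assumes "finite A" and "A \<noteq> {}"
    and "\<And>v. GDERIV f v :> gradf v" and "continuous_on UNIV gradf"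
    and "ORD_run f A \<tau> \<theta> \<gamma> \<delta> \<theta>r \<gamma>r \<epsilon> \<mu>hat Ak cols x xbar y ybar R D"
    and "\<And>k. D k = {a \<in> Ak k.
      \<exists>h<length (cols k). a = cols_mult (cols k) (basis_vec h) \<and> ybar k h = 0}"
    and "x \<longlonglongrightarrow> xstar"
  shows "\<exists>kbar. \<forall>k\<ge>kbar. \<forall>a\<in>A. gradf xstar \<bullet> (a - xstar) > 0 \<longrightarrow> a \<notin> Ak k"
proof -
  interpret ORD_run f A \<tau> \<theta> \<gamma> \<delta> \<theta>r \<gamma>r \<epsilon> \<mu>hat Ak cols x xbar y ybar R D
    by (fact assms(5))
  \<comment> \<open>Finiteness of \<open>A\<close> turns the thresholds of the single atoms into a
    common one.\<close>
  have "\<forall>\<^sub>F k in sequentially. \<forall>a\<in>A. gradf xstar \<bullet> (a - xstar) > 0 \<longrightarrow> a \<notin> Ak k"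
    using assms(1)
  proof (rule eventually_ball_finite, intro ballI)
    fix a
    assume "a \<in> A"
    show "\<forall>\<^sub>F k in sequentially. gradf xstar \<bullet> (a - xstar) > 0 \<longrightarrow> a \<notin> Ak k"
    proof (cases "gradf xstar \<bullet> (a - xstar) > 0")
      case True
      from eventually_not_in_Ak[OF assms(1,3,4,6,7) \<open>a \<in> A\<close> this] show ?thesis
        by (rule eventually_mono) simp
    qed simp
  qed
  then show ?thesis
    by (simp add: eventually_sequentially)
qed

end
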